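(* Let $G$ be a complex unit hypergraph on $n$ vertices and let $\hat G$ be obtained from $G$ by weak-deleting $r$ edges. Then $$\lambda_{j-r}(K(G))\le\lambda_j(K(\hat G))\le\lambda_j(K(G))\qquad\text{for all }j\in\{r+1,\dots,n\}.$$
   Context: Let $\mathbb T=\{z\in\mathbb C:|z|=1\}$. A complex unit hypergraph $G=(V,E,\mathcal I,\omega)$ consists of a finite vertex set $V=\{v_1,\dots,v_n\}$, a finite edge set $E$, an incidence set $\mathcal I\subseteq V\times E$ (write $v\in e$ if $(v,e)\in\mathcal I$), and a function $\omega:V\times E\to\mathbb T\cup\{0\}$ with $\omega(v,e)\neq0$ iff $v\in e$. For distinct $v_i,v_j$ in a common edge $e$, $\varphi_e(v_i,v_j)=-\omega(v_i,e)\,\omega(v_j,e)^{-1}$. The degree of a vertex is the number of edges containing it; $D=\mathrm{diag}(\deg v_1,\dots,\deg v_n)$. The adjacency matrix $A=(a_{ij})$ has $a_{ij}=\sum_{e\ni v_i,v_j}\varphi_e(v_i,v_j)$ (sum over edges containing both) for $i\neq j$ with some edge containing both, and $a_{ij}=0$ otherwise. The Kirchhoff Laplacian $K=D-A$ is Hermitian; $\lambda_1(K)\le\dots\le\lambda_n(K)$ denote its eigenvalues with multiplicity. The weak deletion of an edge $e$ from $G$ is $G\setminus e=(V,E\setminus\{e\},\mathcal I\cap(V\times(E\setminus\{e\})),\omega|_{V\times(E\setminus\{e\})})$; weak-deleting $r$ edges means doing this for $r$ distinct edges. *)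

theory Defs
  imports
    "Jordan_Normal_Form.Char_Poly"
    "HOL-Library.FuncSet"
    "HOL-Library.Multiset"
begin

text \<open>Edges are abstract names rather than vertex sets, so parallel edges and empty edges occur.\<close>

record ('v, 'e) hypergraph =
  verts :: "'v set"
  edges :: "'e set"
  incidence :: "('v \<times> 'e) set"
  omega :: "'v \<times> 'e \<Rightarrow> complex"

definition complex_unit_hypergraph :: "('v, 'e) hypergraph \<Rightarrow> bool" where
  "complex_unit_hypergraph G \<longleftrightarrow>
     finite (verts G) \<and> finite (edges G) \<and>
     incidence G \<subseteq> verts G \<times> edges G \<and>
     omega G \<in> verts G \<times> edges G \<rightarrow>\<^sub>E {z. cmod z = 1} \<union> {0} \<and>
     (\<forall>x\<in>verts G. \<forall>e\<in>edges G. omega G (x, e) \<noteq> 0 \<longleftrightarrow> (x, e) \<in> incidence G)"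

definition weak_delete :: "'e \<Rightarrow> ('v, 'e) hypergraph \<Rightarrow> ('v, 'e) hypergraph" where
  "weak_delete e G =
     \<lparr>verts = verts G,
      edges = edges G - {e},
      incidence = incidence G \<inter> verts G \<times> (edges G - {e}),
      omega = restrict (omega G) (verts G \<times> (edges G - {e}))\<rparr>"

definition phi :: "('v, 'e) hypergraph \<Rightarrow> 'e \<Rightarrow> 'v \<Rightarrow> 'v \<Rightarrow> complex" where
  "phi G e x y = - omega G (x, e) * inverse (omega G (y, e))"

definition degr :: "('v, 'e) hypergraph \<Rightarrow> 'v \<Rightarrow> nat" where
  "degr G x = card {e \<in> edges G. (x, e) \<in> incidence G}"

definition common_edges :: "('v, 'e) hypergraph \<Rightarrow> 'v \<Rightarrow> 'v \<Rightarrow> 'e set" where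
  "common_edges G x y = {e \<in> edges G. (x, e) \<in> incidence G \<and> (y, e) \<in> incidence G}"

text \<open>The matrices are taken with respect to a labelling \<open>v 0, ..., v (n - 1)\<close> of the vertices
  (matrix indices start at 0).\<close>

definition degree_mat :: "('v, 'e) hypergraph \<Rightarrow> (nat \<Rightarrow> 'v) \<Rightarrow> nat \<Rightarrow> complex mat" where
  "degree_mat G v n = mat_diag n (\<lambda>i. of_nat (degr G (v i)))"

definition adjacency_mat :: "('v, 'e) hypergraph \<Rightarrow> (nat \<Rightarrow> 'v) \<Rightarrow> nat \<Rightarrow> complex mat" where
  "adjacency_mat G v n = mat n n (\<lambda>(i, j).
     if i \<noteq> j \<and> common_edges G (v i) (v j) \<noteq> {}
     then \<Sum>e\<in>common_edges G (v i) (v j). phi G e (v i) (v j)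
     else 0)"

definition kirchhoff :: "('v, 'e) hypergraph \<Rightarrow> (nat \<Rightarrow> 'v) \<Rightarrow> nat \<Rightarrow> complex mat" where
  "kirchhoff G v n = degree_mat G v n - adjacency_mat G v n"

definition hermitian_mat :: "complex mat \<Rightarrow> bool" where
  "hermitian_mat A \<longleftrightarrow>
     square_mat A \<and> (\<forall>i<dim_row A. \<forall>j<dim_row A. A $$ (i, j) = cnj (A $$ (j, i)))"

text \<open>The \<open>j\<close>-th smallest eigenvalue counted with multiplicity, \<open>j\<close> running from 1 to the
  dimension. It is meant for Hermitian matrices, whose eigenvalues are real; there \<open>Re\<close> only
  changes the type (see \<open>char_poly_eig\<close> below).\<close>

definition eig :: "complex mat \<Rightarrow> nat \<Rightarrow> real" where
  "eig A j = sorted_list_of_multiset (image_mset Re (proots (char_poly A))) ! (j - 1)"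

lemma complex_unit_hypergraph_weak_delete:
  assumes "complex_unit_hypergraph G"
  shows "complex_unit_hypergraph (weak_delete e G)"
proof -
  have "restrict (omega G) (verts G \<times> (edges G - {e}))
      \<in> verts G \<times> (edges G - {e}) \<rightarrow>\<^sub>E {z. cmod z = 1} \<union> {0}"
  proof (rule restrict_PiE_iff[THEN iffD2], rule ballI)
    fix p assume "p \<in> verts G \<times> (edges G - {e})"
    then have "p \<in> verts G \<times> edges G" by blast
    then show "omega G p \<in> {z. cmod z = 1} \<union> {0}"
      using assms PiE_mem unfolding complex_unit_hypergraph_def by blast
  qed
  then show ?thesis
    using assms unfolding complex_unit_hypergraph_def weak_delete_def by simp
qed

lemma kirchhoff_carrier [simp]: "kirchhoff G v n \<in> carrier_mat n n"
  unfolding kirchhoff_def adjacency_mat_def by (rule minus_carrier_mat) simp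

lemma hermitian_kirchhoff:
  assumes G: "complex_unit_hypergraph G"
  shows "hermitian_mat (kirchhoff G v n)"
proof -
  have sym: "common_edges G x y = common_edges G y x" for x y
    by (auto simp: common_edges_def)
  have phi: "phi G e x y = cnj (phi G e y x)" if "e \<in> common_edges G x y" for e x y
  proof -
    have unit: "cmod (omega G (z, e)) = 1" if "(z, e) \<in> incidence G" "e \<in> edges G" for z
    proof -
      have z: "z \<in> verts G"
        using G that(1) by (auto simp: complex_unit_hypergraph_def)
      then have "omega G (z, e) \<in> {z. cmod z = 1} \<union> {0}"
        using PiE_mem[of "omega G" "verts G \<times> edges G" "\<lambda>_. {z. cmod z = 1} \<union> {0}" "(z, e)"] G that(2)
        unfolding complex_unit_hypergraph_def by blast
      moreover have "omega G (z, e) \<noteq> 0"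
        using G that z by (simp add: complex_unit_hypergraph_def)
      ultimately show ?thesis by simp
    qed
    have "cmod (omega G (x, e)) = 1" "cmod (omega G (y, e)) = 1"
      using that unit by (simp_all add: common_edges_def)
    moreover have "inverse z = cnj z" if "cmod z = 1" for z
      by (rule inverse_unique) (simp add: that flip: complex_norm_square)
    ultimately have "inverse (omega G (x, e)) = cnj (omega G (x, e))"
      "inverse (omega G (y, e)) = cnj (omega G (y, e))"
      by blast+
    then show ?thesis by (simp add: phi_def)
  qed
  have sum: "(\<Sum>e\<in>common_edges G x y. phi G e x y) = cnj (\<Sum>e\<in>common_edges G y x. phi G e y x)"
    for x y
    unfolding sym[of y x] cnj_sum by (rule sum.cong[OF refl]) (rule phi)
  have ent: "kirchhoff G v n $$ (i, j) =
      (if i = j then of_nat (degr G (v i)) else 0) -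
      (if i \<noteq> j then \<Sum>e\<in>common_edges G (v i) (v j). phi G e (v i) (v j) else 0)"
    if "i < n" "j < n" for i j
    using that by (simp add: kirchhoff_def degree_mat_def adjacency_mat_def mat_diag_def)
  have "kirchhoff G v n $$ (i, j) = cnj (kirchhoff G v n $$ (j, i))" if "i < n" "j < n" for i j
  proof (cases "i = j")
    case True
    then show ?thesis using ent[OF that] by simp
  next
    case False
    then show ?thesis
      unfolding ent[OF that] ent[OF that(2,1)] sum[of "v i" "v j"] by simp
  qed
  then show ?thesis
    unfolding hermitian_mat_def carrier_matD[OF kirchhoff_carrier] square_mat.simps by blast
qed

lemma hermitian_eigenvalue_real:
  assumes A: "A \<in> carrier_mat n n" "hermitian_mat A" and ev: "eigenvalue A k"
  shows "Im k = 0"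
proof -
  from ev obtain x where "eigenvector A x k" unfolding eigenvalue_def ..
  then have x: "x \<in> carrier_vec n" "x \<noteq> 0\<^sub>v n" "A *\<^sub>v x = k \<cdot>\<^sub>v x"
    unfolding eigenvector_def carrier_matD(1)[OF A(1)] by blast+
  define q where "q = (\<Sum>i<n. \<Sum>j<n. cnj (x $ i) * A $$ (i, j) * x $ j)"
  define s where "s = (\<Sum>i<n. (cmod (x $ i))\<^sup>2)"
  have "cnj q = (\<Sum>i<n. \<Sum>j<n. cnj (x $ j) * A $$ (j, i) * x $ i)"
    unfolding q_def cnj_sum
  proof (intro sum.cong refl)
    fix i j assume "i \<in> {..<n}" "j \<in> {..<n}"
    then have "A $$ (j, i) = cnj (A $$ (i, j))"
      using A(2) carrier_matD(1)[OF A(1)] unfolding hermitian_mat_def by blast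
    then show "cnj (cnj (x $ i) * A $$ (i, j) * x $ j) = cnj (x $ j) * A $$ (j, i) * x $ i"
      by simp
  qed
  also have "\<dots> = q" unfolding q_def by (rule sum.swap)
  finally have q: "Im q = 0" by (simp add: complex_eq_iff)
  have row: "(\<Sum>j<n. A $$ (i, j) * x $ j) = k * x $ i" if "i < n" for i
  proof -
    have "(A *\<^sub>v x) $ i = (\<Sum>j<n. A $$ (i, j) * x $ j)"
      using A(1) x(1) that by (simp add: scalar_prod_def lessThan_atLeast0)
    moreover have "(A *\<^sub>v x) $ i = k * x $ i"
      unfolding x(3) using x(1) that by simp
    ultimately show ?thesis by simp
  qed
  have "q = (\<Sum>i<n. cnj (x $ i) * (\<Sum>j<n. A $$ (i, j) * x $ j))"
    unfolding q_def by (simp add: sum_distrib_left mult.assoc)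
  also have "\<dots> = (\<Sum>i<n. k * of_real ((cmod (x $ i))\<^sup>2))"
  proof (rule sum.cong[OF refl])
    fix i assume "i \<in> {..<n}"
    then have "(\<Sum>j<n. A $$ (i, j) * x $ j) = k * x $ i" using row by simp
    then show "cnj (x $ i) * (\<Sum>j<n. A $$ (i, j) * x $ j) = k * of_real ((cmod (x $ i))\<^sup>2)"
      unfolding complex_norm_square by (simp only: mult_ac)
  qed
  also have "\<dots> = k * of_real s" by (simp add: s_def sum_distrib_left)
  finally have "Im k * s = 0" using q by simp
  moreover have "s \<noteq> 0"
  proof
    assume "s = 0"
    then have "\<forall>i<n. x $ i = 0" unfolding s_def by (simp add: sum_nonneg_eq_0_iff)
    then have "x = 0\<^sub>v n" using x by (intro eq_vecI) auto
    then show False using x by simp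
  qed
  ultimately show ?thesis by simp
qed

lemma char_poly_eig:
  assumes A: "A \<in> carrier_mat n n" "hermitian_mat A"
  shows "char_poly A = (\<Prod>j\<in>{1..n}. [:- of_real (eig A j), 1:])"
    and "1 \<le> i \<Longrightarrow> i \<le> j \<Longrightarrow> j \<le> n \<Longrightarrow> eig A i \<le> eig A j"
proof -
  define xs where "xs = sorted_list_of_multiset (image_mset Re (proots (char_poly A)))"
  have deg: "degree (char_poly A) = n" "lead_coeff (char_poly A) = 1"
    using degree_monic_char_poly[OF A(1)] by auto
  then have nz: "char_poly A \<noteq> 0" by auto
  have "size (mset xs) = n"
    unfolding xs_def mset_sorted_list_of_multiset by (simp add: size_proots_complex deg)
  then have len: "length xs = n" by simp
  have "sorted xs" by (simp add: xs_def)
  then show "eig A i \<le> eig A j" if "1 \<le> i" "i \<le> j" "j \<le> n"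
    using that len by (auto simp: eig_def xs_def[symmetric] intro!: sorted_nth_mono)
  have "image_mset of_real (mset xs) = image_mset (\<lambda>z. of_real (Re z)) (proots (char_poly A))"
    by (simp add: xs_def multiset.map_comp o_def)
  also have "\<dots> = image_mset (\<lambda>z. z) (proots (char_poly A))"
  proof (rule image_mset_cong)
    fix z assume "z \<in># proots (char_poly A)"
    then have "eigenvalue A z" using nz eigenvalue_root_char_poly[OF A(1)] by simp
    then show "complex_of_real (Re z) = z"
      using hermitian_eigenvalue_real[OF A] by (simp add: complex_eq_iff)
  qed
  finally have roots: "proots (char_poly A) = image_mset of_real (mset xs)" by simp
  have "char_poly A = (\<Prod>z\<in>#proots (char_poly A). [:- z, 1:])"
    using complex_poly_decompose_multiset[of "char_poly A"] deg by simp
  also have "\<dots> = (\<Prod>z\<leftarrow>xs. [:- of_real z, 1:])"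
    unfolding roots by (simp add: multiset.map_comp o_def prod_mset_prod_list flip: mset_map)
  also have "\<dots> = (\<Prod>j<n. [:- of_real (xs ! j), 1:])"
    using len by (simp add: prod.list_conv_set_nth lessThan_atLeast0)
  also have "\<dots> = (\<Prod>j\<in>{1..n}. [:- of_real (eig A j), 1:])"
    by (rule prod.reindex_bij_witness[of _ "\<lambda>j. j - 1" Suc]) (auto simp: eig_def xs_def)
  finally show "char_poly A = (\<Prod>j\<in>{1..n}. [:- of_real (eig A j), 1:])" .
qed

end

theory Submission
  imports Defs "Jordan_Normal_Form.Schur_Decomposition"
begin

text \<open>Writing \<open>w\<^sub>e\<close> for the column of \<open>\<omega>\<close> belonging to the edge \<open>e\<close>, the Kirchhoff
  Laplacian is the sum of the rank one matrices \<open>w\<^sub>e w\<^sub>e\<^sup>*\<close>, so its quadratic form is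
  \<open>x \<mapsto> \<Sum>e. \<bar>w\<^sub>e\<^sup>* x\<bar>\<^sup>2\<close>. Weak deletion of \<open>r\<close> edges drops \<open>r\<close> nonnegative terms:
  the form decreases, and it is unchanged on the subspace of codimension at most \<open>r\<close> orthogonal
  to the deleted \<open>w\<^sub>e\<close>. Both inequalities then follow by comparing the forms at a vector in
  the intersection of spans of eigenvectors, which is nonzero for reasons of dimension.\<close>

section \<open>Adjoints of complex matrices\<close>

lemma mat_adjoint_carrier [simp]:
  "A \<in> carrier_mat n m \<Longrightarrow> mat_adjoint A \<in> carrier_mat m n"
  unfolding mat_adjoint_def by auto

lemma mat_adjoint_dim [simp]:
  "dim_row (mat_adjoint A) = dim_col A" "dim_col (mat_adjoint A) = dim_row A"
  unfolding mat_adjoint_def by auto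

lemma mat_adjoint_index [simp]:
  fixes A :: "complex mat"
  shows "i < dim_col A \<Longrightarrow> j < dim_row A \<Longrightarrow> mat_adjoint A $$ (i, j) = cnj (A $$ (j, i))"
  unfolding mat_adjoint_def by (simp add: mat_of_rows_index)

text \<open>Turns the entrywise condition into an equation between matrices, which passes to
  \<open>mat_adjoint W * A * W\<close> by mere algebra.\<close>

lemma hermitian_mat_iff_adjoint:
  assumes "A \<in> carrier_mat n n"
  shows "hermitian_mat A \<longleftrightarrow> mat_adjoint A = A"
proof
  assume A: "hermitian_mat A"
  show "mat_adjoint A = A"
  proof (rule eq_matI)
    fix i j assume "i < dim_row A" "j < dim_col A"
    then have ij: "i < n" "j < n" using assms by auto
    then have "A $$ (i, j) = cnj (A $$ (j, i))"
      using A assms unfolding hermitian_mat_def by blast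
    then show "mat_adjoint A $$ (i, j) = A $$ (i, j)"
      using ij assms by (simp only: mat_adjoint_index carrier_matD)
  qed (use assms in auto)
next
  assume *: "mat_adjoint A = A"
  show "hermitian_mat A"
    unfolding hermitian_mat_def
  proof (intro conjI allI impI)
    show "square_mat A" using assms by simp
    fix i j assume "i < dim_row A" "j < dim_row A"
    then show "A $$ (i, j) = cnj (A $$ (j, i))"
      using assms by (subst *[symmetric]) simp
  qed
qed

lemma mat_adjoint_mult:
  fixes A B :: "complex mat"
  assumes "A \<in> carrier_mat n m" "B \<in> carrier_mat m k"
  shows "mat_adjoint (A * B) = mat_adjoint B * mat_adjoint A"
  using assms by (intro eq_matI) (auto simp: scalar_prod_def mult.commute)

lemma mat_adjoint_adjoint [simp]:
  fixes A :: "complex mat"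
  shows "mat_adjoint (mat_adjoint A) = A"
  by (intro eq_matI) auto

text \<open>Serves the deflation step of \<open>hermitian_diagonalization\<close>, where a block of
  size 1 is split off.\<close>

lemma mat_adjoint_block_diag:
  fixes A D :: "complex mat"
  assumes "A \<in> carrier_mat n n" "D \<in> carrier_mat m m"
  shows "mat_adjoint (four_block_mat A (0\<^sub>m n m) (0\<^sub>m m n) D) =
    four_block_mat (mat_adjoint A) (0\<^sub>m n m) (0\<^sub>m m n) (mat_adjoint D)"
  using assms by (intro eq_matI) auto

lemma mult_block_diag:
  fixes A B C D :: "'a :: comm_ring_1 mat"
  assumes "A \<in> carrier_mat n n" "D \<in> carrier_mat m m" "B \<in> carrier_mat n n" "C \<in> carrier_mat m m"
  shows "four_block_mat A (0\<^sub>m n m) (0\<^sub>m m n) D * four_block_mat B (0\<^sub>m n m) (0\<^sub>m m n) C =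
    four_block_mat (A * B) (0\<^sub>m n m) (0\<^sub>m m n) (D * C)"
  using assms by (subst mult_four_block_mat[where ?nr1.0 = n and ?n1.0 = n and ?n2.0 = m
        and ?nr2.0 = m and ?nc1.0 = n and ?nc2.0 = m]) auto

lemma cscalar_prod_self:
  fixes x :: "complex vec"
  shows "x \<bullet>c x = of_real (\<Sum>i<dim_vec x. (cmod (x $ i))\<^sup>2)"
  by (simp add: scalar_prod_def complex_norm_square lessThan_atLeast0 del: of_real_power)

text \<open>\<open>\<bullet>c\<close> conjugates its second argument, so the adjoint appears on that
  side once the two finite sums are exchanged.\<close>

lemma cscalar_prod_mat_adjoint:
  fixes A :: "complex mat"
  assumes "A \<in> carrier_mat n m" "x \<in> carrier_vec m" "y \<in> carrier_vec n"
  shows "(A *\<^sub>v x) \<bullet>c y = x \<bullet>c (mat_adjoint A *\<^sub>v y)"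
proof -
  have "(A *\<^sub>v x) \<bullet>c y = (\<Sum>i<n. \<Sum>j<m. A $$ (i, j) * x $ j * cnj (y $ i))"
    using assms by (simp add: scalar_prod_def sum_distrib_right lessThan_atLeast0)
  also have "\<dots> = (\<Sum>j<m. \<Sum>i<n. A $$ (i, j) * x $ j * cnj (y $ i))"
    by (rule sum.swap)
  also have "\<dots> = x \<bullet>c (mat_adjoint A *\<^sub>v y)"
    using assms by (simp add: scalar_prod_def sum_distrib_left lessThan_atLeast0 mult_ac)
  finally show ?thesis .
qed

section \<open>Unitary diagonalization of Hermitian matrices\<close>

text \<open>Complete \<open>x\<close> to a basis, orthogonalize by Gram-Schmidt, which keeps the
  first vector, and normalize. The factor \<open>c\<close> comes from the normalization; it can stay
  unspecified because multiples of an eigenvector still satisfy the eigenvalue equation.\<close>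

lemma exists_unitary_with_first_column:
  fixes x :: "complex vec"
  assumes x: "x \<in> carrier_vec n" "x \<noteq> 0\<^sub>v n"
  obtains U c where "U \<in> carrier_mat n n" "mat_adjoint U * U = 1\<^sub>m n" "col U 0 = c \<cdot>\<^sub>v x"
proof -
  interpret cof_vec_space n "TYPE(complex)" .
  define b where "b = basis_completion x"
  note b = basis_completion[OF x, folded b_def]
  have n: "0 < n" using x by (auto intro!: Nat.gr0I)
  define ws where "ws = gram_schmidt n b"
  note gs = gram_schmidt_result[OF b(2,4,5) ws_def]
  have len: "length ws = n" using gs b by simp
  obtain bs where "b = x # bs" using b(6,7) n by (cases b) auto
  then have "hd ws = x" unfolding ws_def using gram_schmidt_hd[OF x(1)] by simp
  then have ws0: "ws ! 0 = x" using len n by (simp add: hd_conv_nth[symmetric] flip: length_greater_0_conv)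
  \<comment> \<open>\<open>a w\<close> is the reciprocal of the Euclidean norm of \<open>w\<close>:
    Gram-Schmidt leaves the vectors \<open>ws\<close> orthogonal but not normalized.\<close>
  define a where "a w = complex_of_real (1 / sqrt (\<Sum>i<dim_vec w. (cmod (w $ i))\<^sup>2))" for w :: "complex vec"
  define U where "U = mat_of_cols n (map (\<lambda>w. a w \<cdot>\<^sub>v w) ws)"
  have U: "U \<in> carrier_mat n n" unfolding U_def using len by (metis length_map mat_of_cols_carrier(1))
  have w: "ws ! i \<in> carrier_vec n" if "i < n" for i using gs(3) len that by auto
  have col: "col U i = a (ws ! i) \<cdot>\<^sub>v ws ! i" if "i < n" for i
    unfolding U_def using that len w by (subst col_mat_of_cols) auto
  have "mat_adjoint U * U = 1\<^sub>m n"
  proof (rule eq_matI)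
    fix i j assume "i < dim_row (1\<^sub>m n :: complex mat)" "j < dim_col (1\<^sub>m n :: complex mat)"
    then have ij: "i < n" "j < n" by auto
    have "(mat_adjoint U * U) $$ (i, j) = col U j \<bullet>c col U i"
      using U ij by (simp add: scalar_prod_def mult.commute)
    also have "\<dots> = a (ws ! j) * cnj (a (ws ! i)) * (ws ! j \<bullet>c ws ! i)"
      using carrier_vecD[OF w[OF ij(1)]] carrier_vecD[OF w[OF ij(2)]] ij
      by (simp add: col scalar_prod_def sum_distrib_left mult_ac)
    also have "\<dots> = 1\<^sub>m n $$ (i, j)"
    proof (cases "i = j")
      case False
      then show ?thesis using corthogonalD[OF gs(2), of j i] ij len by simp
    next
      case True
      define s where "s = (\<Sum>k<dim_vec (ws ! j). (cmod (ws ! j $ k))\<^sup>2)"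
      \<comment> \<open>\<open>corthogonal\<close> also says that no vector of the list has
        vanishing product with itself, which gives \<open>s > 0\<close> and makes the normalization
        legitimate.\<close>
      have "ws ! j \<bullet>c ws ! j \<noteq> 0" using corthogonalD[OF gs(2), of j j] ij len by simp
      then have "s \<noteq> 0" unfolding cscalar_prod_self s_def[symmetric] by simp
      moreover have "s \<ge> 0" unfolding s_def by (rule sum_nonneg) simp
      ultimately have "s > 0" by simp
      then have "1 / sqrt s * (1 / sqrt s) * s = 1" by simp
      then have "a (ws ! j) * cnj (a (ws ! j)) * (ws ! j \<bullet>c ws ! j) = 1"
        unfolding cscalar_prod_self a_def s_def[symmetric] complex_cnj_complex_of_real
        by (simp only: of_real_1 flip: of_real_mult)
      then show ?thesis using True ij by simp
    qed
    finally show "(mat_adjoint U * U) $$ (i, j) = 1\<^sub>m n $$ (i, j)" .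
  qed (use U in auto)
  with U show thesis using that col[OF n] ws0 by auto
qed

text \<open>Deflation, by induction on the list of roots. Conjugating by a unitary whose first
  column is an eigenvector for \<open>e\<close> splits off a block of size 1; the other block is
  Hermitian and has the remaining roots. The diagonal follows the order of \<open>es\<close>, so a
  sorted list of eigenvalues stays sorted.\<close>

lemma hermitian_diagonalization:
  assumes "A \<in> carrier_mat n n" "hermitian_mat A" "char_poly A = (\<Prod>e\<leftarrow>es. [:- e, 1:])"
  shows "\<exists>U\<in>carrier_mat n n. mat_adjoint U * U = 1\<^sub>m n \<and>
    mat_adjoint U * A * U = mat_diag n (\<lambda>i. es ! i)"
  using assms
proof (induction es arbitrary: n A)
  case Nil
  then have "n = 0" using degree_monic_char_poly[of A n] by simp
  then show ?case using Nil(1)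
    by (intro bexI[of _ "1\<^sub>m n"] conjI eq_matI) (auto simp: mat_diag_def)
next
  case (Cons e es)
  note A = Cons.prems(1)
  have adjA: "mat_adjoint A = A" using Cons.prems(1,2) hermitian_mat_iff_adjoint by blast
  have "eigenvalue A e" unfolding eigenvalue_root_char_poly[OF A] Cons.prems(3) by simp
  then obtain x where x: "x \<in> carrier_vec n" "x \<noteq> 0\<^sub>v n" "A *\<^sub>v x = e \<cdot>\<^sub>v x"
    using A unfolding eigenvalue_def eigenvector_def by auto
  obtain m where n: "n = Suc m" using x by (cases n) auto
  obtain W c where W: "W \<in> carrier_mat n n" "mat_adjoint W * W = 1\<^sub>m n" "col W 0 = c \<cdot>\<^sub>v x"
    using exists_unitary_with_first_column[OF x(1,2)] .
  have W': "mat_adjoint W \<in> carrier_mat n n" using W by simp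
  have WW': "W * mat_adjoint W = 1\<^sub>m n" by (rule mat_mult_left_right_inverse[OF W' W(1,2)])
  define B where "B = mat_adjoint W * A * W"
  have B: "B \<in> carrier_mat n n" unfolding B_def using W W' A by auto
  have adjB: "mat_adjoint B = B"
    unfolding B_def using W(1) W' A
    by (simp add: mat_adjoint_mult[of _ n n _ n] adjA assoc_mult_mat[of _ n n _ n _ n] del: mat_adjoint_carrier)
  have W0: "col W 0 \<in> carrier_vec n" using W(1) by auto
  \<comment> \<open>The first column of \<open>W\<close> satisfies the eigenvalue equation, so the
    first column of \<open>B\<close> is \<open>e\<close> times the first column of
    \<open>mat_adjoint W * W\<close>, which is the identity.\<close>
  have "col B 0 = mat_adjoint W * A *\<^sub>v col W 0"
    unfolding B_def using W(1) W' A n by (intro col_mult2) auto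
  also have "\<dots> = mat_adjoint W *\<^sub>v (A *\<^sub>v col W 0)"
    by (rule assoc_mult_mat_vec[OF W' A W0])
  also have "A *\<^sub>v col W 0 = e \<cdot>\<^sub>v col W 0"
    unfolding W(3) using A x by (simp add: mult_mat_vec smult_smult_assoc mult.commute)
  also have "mat_adjoint W *\<^sub>v (e \<cdot>\<^sub>v col W 0) = e \<cdot>\<^sub>v col (mat_adjoint W * W) 0"
    using W(1) n by (simp add: mult_mat_vec[OF W' W0] col_mult2[OF W' W(1)])
  finally have col: "col B 0 = e \<cdot>\<^sub>v col (1\<^sub>m n) 0" unfolding W(2) .
  have Bi0: "B $$ (i, 0) = (if i = 0 then e else 0)" if "i < n" for i
    using arg_cong[OF col, of "\<lambda>v. v $ i"] that B n by auto
  \<comment> \<open>As a diagonal entry of a Hermitian matrix, \<open>e\<close> is real. Hence the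
    first row of \<open>B\<close> has the same entries as the first column, and \<open>B\<close> is
    block diagonal.\<close>
  have "B $$ (0, 0) = cnj (B $$ (0, 0))"
    using B n by (subst adjB[symmetric]) simp
  then have e: "cnj e = e" using Bi0[of 0] n by simp
  have B0i: "B $$ (0, i) = (if i = 0 then e else 0)" if "i < n" for i
    using B n Bi0[OF that] that e by (subst adjB[symmetric]) simp
  define C where "C = mat m m (\<lambda>(i, j). B $$ (Suc i, Suc j))"
  have C: "C \<in> carrier_mat m m" unfolding C_def by simp
  define E where "E = mat 1 1 (\<lambda>_. e)"
  have E: "E \<in> carrier_mat 1 1" unfolding E_def by simp
  have BC: "B = four_block_mat E (0\<^sub>m 1 m) (0\<^sub>m m 1) C"
    using B n by (intro eq_matI) (auto simp: E_def C_def Bi0 B0i)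
  have "mat_adjoint C = C"
  proof (intro eq_matI)
    fix i j assume "i < dim_row C" "j < dim_col C"
    then have ij: "i < m" "j < m" using C by auto
    have "mat_adjoint B $$ (Suc i, Suc j) = B $$ (Suc i, Suc j)" unfolding adjB ..
    then show "mat_adjoint C $$ (i, j) = C $$ (i, j)"
      using B n ij by (simp add: C_def)
  qed (use C in auto)
  then have hC: "hermitian_mat C" using hermitian_mat_iff_adjoint[OF C] by simp
  have "similar_mat_wit B A (mat_adjoint W) W"
    by (rule similar_mat_witI[of _ _ n]) (use W W' WW' A B B_def in auto)
  then have "char_poly B = char_poly A" by (intro char_poly_similar) (auto simp: similar_mat_def)
  moreover have "char_poly B = char_poly E * char_poly C"
    unfolding BC by (rule char_poly_four_block_zeros_col) (use E C in auto)
  moreover have "char_poly E = [:- e, 1:]"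
    by (simp add: E_def char_poly_defs det_def sign_def)
  ultimately have "[:- e, 1:] * char_poly C = [:- e, 1:] * (\<Prod>e\<leftarrow>es. [:- e, 1:])"
    using Cons.prems(3) by simp
  then have "char_poly C = (\<Prod>e\<leftarrow>es. [:- e, 1:])"
    by (metis mult_cancel_left pCons_eq_0_iff zero_neq_one)
  from Cons.IH[OF C hC this] obtain P where P: "P \<in> carrier_mat m m"
    "mat_adjoint P * P = 1\<^sub>m m" "mat_adjoint P * C * P = mat_diag m (\<lambda>i. es ! i)"
    by blast
  \<comment> \<open>\<open>F\<close> applies \<open>P\<close> to the second block and leaves the
    split-off coordinate alone; \<open>W * F\<close> then diagonalizes \<open>A\<close>.\<close>
  define F where "F = four_block_mat (1\<^sub>m 1) (0\<^sub>m 1 m) (0\<^sub>m m 1) P"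
  have adj1: "mat_adjoint (1\<^sub>m 1) = (1\<^sub>m 1 :: complex mat)" by (intro eq_matI) auto
  have F: "F \<in> carrier_mat n n" unfolding F_def n using P by auto
  have F': "mat_adjoint F \<in> carrier_mat n n" using F by simp
  have adjF: "mat_adjoint F = four_block_mat (1\<^sub>m 1) (0\<^sub>m 1 m) (0\<^sub>m m 1) (mat_adjoint P)"
    unfolding F_def mat_adjoint_block_diag[OF one_carrier_mat P(1)] adj1 ..
  have FF: "mat_adjoint F * F = 1\<^sub>m n"
    unfolding adjF unfolding F_def
    by (subst mult_block_diag) (use P n in \<open>auto intro!: eq_matI\<close>)
  have "mat_adjoint F * B * F =
      four_block_mat (1\<^sub>m 1 * E * 1\<^sub>m 1) (0\<^sub>m 1 m) (0\<^sub>m m 1) (mat_adjoint P * C * P)"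
    unfolding adjF unfolding F_def BC
    by (subst mult_block_diag, (use P E C in auto)[4], subst mult_block_diag, use P E C in auto)
  also have "\<dots> = mat_diag n (\<lambda>i. (e # es) ! i)"
    unfolding P(3) using n by (intro eq_matI) (auto simp: E_def mat_diag_def scalar_prod_def nth_Cons')
  finally have FBF: "mat_adjoint F * B * F = mat_diag n (\<lambda>i. (e # es) ! i)" .
  have adjWF: "mat_adjoint (W * F) = mat_adjoint F * mat_adjoint W"
    by (rule mat_adjoint_mult[OF W(1) F])
  have "mat_adjoint (W * F) * (W * F) = mat_adjoint F * (mat_adjoint W * W) * F"
    unfolding adjWF using W(1) W' F F' by (simp add: assoc_mult_mat[of _ n n _ n _ n] del: mat_adjoint_carrier)
  then have "mat_adjoint (W * F) * (W * F) = 1\<^sub>m n"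
    unfolding W(2) right_mult_one_mat[OF F'] FF .
  moreover have "mat_adjoint (W * F) * A * (W * F) = mat_adjoint F * B * F"
    unfolding adjWF B_def using W(1) W' F F' A by (simp add: assoc_mult_mat[of _ n n _ n _ n] del: mat_adjoint_carrier)
  ultimately show ?case using FBF W(1) F by (intro bexI[of _ "W * F"]) auto
qed

text \<open>The spectral theorem in coordinates: the numbers \<open>x \<bullet>c col U i\<close> are
  the entries of \<open>mat_adjoint U *\<^sub>v x\<close>. The two equations are Parseval's identity
  and the expansion of the quadratic form in eigenvalues. \<open>eig\<close> counts from 1 and
  columns from 0, hence \<open>Suc i\<close>.\<close>

lemma hermitian_orthonormal_eigenbasis:
  assumes A: "A \<in> carrier_mat n n" "hermitian_mat A"
  obtains U where "U \<in> carrier_mat n n"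
    and "\<And>x. x \<in> carrier_vec n \<Longrightarrow>
      (\<Sum>i<n. (cmod (x $ i))\<^sup>2) = (\<Sum>i<n. (cmod (x \<bullet>c col U i))\<^sup>2)"
    and "\<And>x. x \<in> carrier_vec n \<Longrightarrow>
      (A *\<^sub>v x) \<bullet>c x = of_real (\<Sum>i<n. eig A (Suc i) * (cmod (x \<bullet>c col U i))\<^sup>2)"
proof -
  define es where "es = map (\<lambda>i. complex_of_real (eig A (Suc i))) [0..<n]"
  have "char_poly A = (\<Prod>j\<in>{1..n}. [:- of_real (eig A j), 1:])"
    by (rule char_poly_eig(1)[OF A])
  also have "\<dots> = (\<Prod>j<n. [:- of_real (eig A (Suc j)), 1:])"
    by (rule prod.reindex_bij_witness[of _ Suc "\<lambda>j. j - 1"]) auto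
  also have "\<dots> = (\<Prod>e\<leftarrow>es. [:- e, 1:])"
    by (simp add: es_def prod.list_conv_set_nth lessThan_atLeast0)
  finally have "char_poly A = (\<Prod>e\<leftarrow>es. [:- e, 1:])" .
  from hermitian_diagonalization[OF A this] obtain U where U: "U \<in> carrier_mat n n"
    "mat_adjoint U * U = 1\<^sub>m n" "mat_adjoint U * A * U = mat_diag n (\<lambda>i. es ! i)"
    by blast
  define D where "D = mat_diag n (\<lambda>i. es ! i)"
  have D: "D \<in> carrier_mat n n" by (simp add: D_def)
  have U': "mat_adjoint U \<in> carrier_mat n n" using U by simp
  have UU': "U * mat_adjoint U = 1\<^sub>m n" by (rule mat_mult_left_right_inverse[OF U' U(1,2)])
  have "U * D * mat_adjoint U = (U * mat_adjoint U) * A * (U * mat_adjoint U)"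
    unfolding D_def U(3)[symmetric] using U(1) U' A
    by (simp add: assoc_mult_mat[of _ n n _ n _ n] del: mat_adjoint_carrier)
  then have AD: "A = U * D * mat_adjoint U" unfolding UU' using A by simp
  have coord: "(mat_adjoint U *\<^sub>v x) $ i = x \<bullet>c col U i"
    if "x \<in> carrier_vec n" "i < n" for x i
    using that U(1) by (simp add: scalar_prod_def mult.commute)
  have norm: "(\<Sum>i<n. (cmod (x $ i))\<^sup>2) = (\<Sum>i<n. (cmod (x \<bullet>c col U i))\<^sup>2)"
    if x: "x \<in> carrier_vec n" for x
  proof -
    let ?y = "mat_adjoint U *\<^sub>v x"
    have y: "?y \<in> carrier_vec n" using U' x by simp
    \<comment> \<open>With \<open>x\<close> written as \<open>U\<close> applied to its coordinate
      vector, the outer \<open>U\<close> moves across the product as an adjoint.\<close>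
    have "x = (U * mat_adjoint U) *\<^sub>v x" unfolding UU' using x by simp
    also have "\<dots> = U *\<^sub>v ?y" by (rule assoc_mult_mat_vec[OF U(1) U' x])
    finally have "x \<bullet>c x = (U *\<^sub>v ?y) \<bullet>c x" by simp
    also have "\<dots> = ?y \<bullet>c ?y" by (rule cscalar_prod_mat_adjoint[OF U(1) y x])
    finally have "(\<Sum>i<n. (cmod (x $ i))\<^sup>2) = (\<Sum>i<n. (cmod (?y $ i))\<^sup>2)"
      unfolding cscalar_prod_self of_real_eq_iff carrier_vecD[OF x] carrier_vecD[OF y] .
    then show ?thesis using coord[OF x] by simp
  qed
  have form: "(A *\<^sub>v x) \<bullet>c x = of_real (\<Sum>i<n. eig A (Suc i) * (cmod (x \<bullet>c col U i))\<^sup>2)"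
    if x: "x \<in> carrier_vec n" for x
  proof -
    define y where "y = mat_adjoint U *\<^sub>v x"
    have y: "y \<in> carrier_vec n" unfolding y_def using U' x by simp
    have "A *\<^sub>v x = U *\<^sub>v (D *\<^sub>v y)"
      by (subst AD) (use y_def U(1) U' D x in \<open>simp add: assoc_mult_mat_vec[of _ n n _ n] del: mat_adjoint_carrier\<close>)
    then have "(A *\<^sub>v x) \<bullet>c x = (D *\<^sub>v y) \<bullet>c y"
      using cscalar_prod_mat_adjoint[OF U(1) _ x, of "D *\<^sub>v y"] D y by (simp flip: y_def)
    also have "\<dots> = (\<Sum>i<n. (D *\<^sub>v y) $ i * cnj (y $ i))"
      using y by (simp add: scalar_prod_def lessThan_atLeast0)
    also have "\<dots> = (\<Sum>i<n. of_real (eig A (Suc i) * (cmod (y $ i))\<^sup>2))"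
    proof (rule sum.cong[OF refl])
      fix i assume "i \<in> {..<n}"
      then have i: "i < n" by simp
      have "(D *\<^sub>v y) $ i = (\<Sum>j<n. (if j = i then es ! i else 0) * y $ j)"
        using i y by (auto simp: D_def mat_diag_def scalar_prod_def lessThan_atLeast0 intro!: sum.cong)
      also have "\<dots> = (\<Sum>j<n. if j = i then es ! i * y $ i else 0)"
        by (rule sum.cong) auto
      also have "\<dots> = of_real (eig A (Suc i)) * y $ i"
        using i by (simp add: es_def)
      finally show "(D *\<^sub>v y) $ i * cnj (y $ i) = of_real (eig A (Suc i) * (cmod (y $ i))\<^sup>2)"
        by (simp add: complex_norm_square mult.assoc del: of_real_power)
    qed
    finally show ?thesis using coord[OF x, folded y_def] by simp
  qed
  show thesis by (rule that[OF U(1) norm form])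
qed

section \<open>Eigenvalue comparison from quadratic forms\<close>

text \<open>Fewer than \<open>n\<close> homogeneous linear equations in \<open>n\<close> unknowns:
  padded with zero rows to a square matrix, the system has determinant zero and so a nontrivial
  kernel.\<close>

lemma exists_nonzero_orthogonal_vec:
  fixes as :: "'a :: field vec list"
  assumes "set as \<subseteq> carrier_vec n" "length as < n"
  obtains x where "x \<in> carrier_vec n" "x \<noteq> 0\<^sub>v n" "\<And>a. a \<in> set as \<Longrightarrow> a \<bullet> x = 0"
proof -
  define c where "c i = (if i < length as then as ! i else 0\<^sub>v n)" for i
  \<comment> \<open>Since \<open>length as < n\<close>, the last row is free; writing it as an
    explicit zero row matches the form of \<open>det_row_0\<close>.\<close>
  define M where "M = mat\<^sub>r n n (\<lambda>i. if i = n - 1 then 0\<^sub>v n else c i)"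
  have M: "M \<in> carrier_mat n n" by (simp add: M_def)
  have c: "c i \<in> carrier_vec n" for i using assms(1) by (auto simp: c_def)
  have "det M = 0" unfolding M_def using assms(2) c by (intro det_row_0) auto
  then obtain x where x: "x \<in> carrier_vec n" "x \<noteq> 0\<^sub>v n" "M *\<^sub>v x = 0\<^sub>v n"
    using det_0_iff_vec_prod_zero_field[OF M] by blast
  have "a \<bullet> x = 0" if "a \<in> set as" for a
  proof -
    obtain i where i: "i < length as" "a = as ! i" using \<open>a \<in> set as\<close> by (metis in_set_conv_nth)
    then have "a = row M i" using c[of i] assms(2) i(1)
      by (cases "i = n - 1") (simp_all add: M_def c_def)
    then have "a \<bullet> x = (M *\<^sub>v x) $ i" using i assms M by simp
    then show ?thesis using i assms x by simp
  qed
  with x show thesis using that by blast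
qed

text \<open>A Courant-Fischer argument with \<open>k = j - length ws\<close>: test the forms at a
  nonzero \<open>x\<close> that meets the conditions \<open>ws\<close> and is orthogonal to the
  first \<open>k - 1\<close> eigenvectors of \<open>A\<close> and to those of \<open>B\<close>
  beyond the \<open>j\<close>-th. The list \<open>ws\<close> costs its length in the index, whether
  or not its members are independent.\<close>

lemma eig_le_of_quadratic_form_le:
  assumes A: "A \<in> carrier_mat n n" "hermitian_mat A"
    and B: "B \<in> carrier_mat n n" "hermitian_mat B"
    and ws: "set ws \<subseteq> carrier_vec n" "length ws < j" and j: "j \<le> n"
    and le: "\<And>x. x \<in> carrier_vec n \<Longrightarrow> (\<And>w. w \<in> set ws \<Longrightarrow> w \<bullet> x = 0) \<Longrightarrow>
      Re ((A *\<^sub>v x) \<bullet>c x) \<le> Re ((B *\<^sub>v x) \<bullet>c x)"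
  shows "eig A (j - length ws) \<le> eig B j"
proof -
  define k where "k = j - length ws"
  obtain U where U: "U \<in> carrier_mat n n"
    and U_norm: "\<And>x. x \<in> carrier_vec n \<Longrightarrow>
      (\<Sum>i<n. (cmod (x $ i))\<^sup>2) = (\<Sum>i<n. (cmod (x \<bullet>c col U i))\<^sup>2)"
    and U_form: "\<And>x. x \<in> carrier_vec n \<Longrightarrow>
      (A *\<^sub>v x) \<bullet>c x = of_real (\<Sum>i<n. eig A (Suc i) * (cmod (x \<bullet>c col U i))\<^sup>2)"
    using hermitian_orthonormal_eigenbasis[OF A] by blast
  obtain V where V: "V \<in> carrier_mat n n"
    and V_norm: "\<And>x. x \<in> carrier_vec n \<Longrightarrow>
      (\<Sum>i<n. (cmod (x $ i))\<^sup>2) = (\<Sum>i<n. (cmod (x \<bullet>c col V i))\<^sup>2)"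
    and V_form: "\<And>x. x \<in> carrier_vec n \<Longrightarrow>
      (B *\<^sub>v x) \<bullet>c x = of_real (\<Sum>i<n. eig B (Suc i) * (cmod (x \<bullet>c col V i))\<^sup>2)"
    using hermitian_orthonormal_eigenbasis[OF B] by blast
  \<comment> \<open>\<open>(k - 1) + (n - j) + length ws = n - 1\<close> linear conditions on \<open>x\<close>\<close>
  define as where "as = map (\<lambda>i. conjugate (col U i)) [0..<k - 1] @
    map (\<lambda>i. conjugate (col V i)) [j..<n] @ ws"
  have "set as \<subseteq> carrier_vec n" using U V ws by (auto simp: as_def)
  moreover have "length as < n" using ws(2) j by (simp add: as_def k_def)
  ultimately obtain x where x: "x \<in> carrier_vec n" "x \<noteq> 0\<^sub>v n"
    and orth: "\<And>a. a \<in> set as \<Longrightarrow> a \<bullet> x = 0"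
    by (rule exists_nonzero_orthogonal_vec) blast
  have xU: "x \<bullet>c col U i = 0" if "i < k - 1" for i
    using that orth[of "conjugate (col U i)"] x U comm_scalar_prod[of "conjugate (col U i)" n x]
    by (auto simp: as_def)
  have xV: "x \<bullet>c col V i = 0" if "j \<le> i" "i < n" for i
    using that orth[of "conjugate (col V i)"] x V comm_scalar_prod[of "conjugate (col V i)" n x]
    by (auto simp: as_def)
  define s where "s = (\<Sum>i<n. (cmod (x $ i))\<^sup>2)"
  have "x \<bullet>c x = of_real s"
    unfolding cscalar_prod_self s_def using x(1) by simp
  then have "s \<noteq> 0" using conjugate_square_eq_0_vec[OF x(1)] x(2) by auto
  moreover have "s \<ge> 0" unfolding s_def by (rule sum_nonneg) simp
  ultimately have s: "s > 0" by simp
  \<comment> \<open>At \<open>x\<close> only eigenvalues of \<open>A\<close> with index at least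
    \<open>k\<close> and of \<open>B\<close> with index at most \<open>j\<close> can carry nonzero
    coefficients. So \<open>eig A k * s\<close> bounds the first form from below,
    \<open>eig B j * s\<close> bounds the second from above, and \<open>s > 0\<close>
    cancels.\<close>
  have "eig A k * s = (\<Sum>i<n. eig A k * (cmod (x \<bullet>c col U i))\<^sup>2)"
    unfolding s_def U_norm[OF x(1)] by (rule sum_distrib_left)
  also have "\<dots> \<le> (\<Sum>i<n. eig A (Suc i) * (cmod (x \<bullet>c col U i))\<^sup>2)"
  proof (rule sum_mono)
    fix i assume "i \<in> {..<n}"
    then have i: "i < n" by simp
    show "eig A k * (cmod (x \<bullet>c col U i))\<^sup>2 \<le> eig A (Suc i) * (cmod (x \<bullet>c col U i))\<^sup>2"
    proof (cases "i < k - 1")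
      case True
      then show ?thesis using xU by simp
    next
      case False
      then have "eig A k \<le> eig A (Suc i)"
        using i ws(2) by (intro char_poly_eig(2)[OF A]) (auto simp: k_def)
      then show ?thesis by (rule mult_right_mono) simp
    qed
  qed
  also have "\<dots> = Re ((A *\<^sub>v x) \<bullet>c x)" unfolding U_form[OF x(1)] by simp
  also have "\<dots> \<le> Re ((B *\<^sub>v x) \<bullet>c x)" by (rule le[OF x(1)], rule orth) (simp add: as_def)
  also have "\<dots> = (\<Sum>i<n. eig B (Suc i) * (cmod (x \<bullet>c col V i))\<^sup>2)"
    unfolding V_form[OF x(1)] by simp
  also have "\<dots> \<le> (\<Sum>i<n. eig B j * (cmod (x \<bullet>c col V i))\<^sup>2)"
  proof (rule sum_mono)
    fix i assume "i \<in> {..<n}"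
    then have i: "i < n" by simp
    show "eig B (Suc i) * (cmod (x \<bullet>c col V i))\<^sup>2 \<le> eig B j * (cmod (x \<bullet>c col V i))\<^sup>2"
    proof (cases "j \<le> i")
      case True
      then show ?thesis using xV i by simp
    next
      case False
      then have "eig B (Suc i) \<le> eig B j"
        using i j by (intro char_poly_eig(2)[OF B]) auto
      then show ?thesis by (rule mult_right_mono) simp
    qed
  qed
  also have "\<dots> = eig B j * s"
    unfolding s_def V_norm[OF x(1)] by (rule sum_distrib_left[symmetric])
  finally show ?thesis using s by (simp add: k_def)
qed

section \<open>The Kirchhoff Laplacian as a sum over edges\<close>

text \<open>The entries are conjugated because \<open>\<bullet>\<close> is bilinear: \<open>edge_vec G v n e \<bullet> x\<close> is the
  Hermitian product \<open>w\<^sub>e\<^sup>* x\<close>.\<close>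

definition edge_vec :: "('v, 'e) hypergraph \<Rightarrow> (nat \<Rightarrow> 'v) \<Rightarrow> nat \<Rightarrow> 'e \<Rightarrow> complex vec" where
  "edge_vec G v n e = vec n (\<lambda>i. cnj (omega G (v i, e)))"

lemma edge_vec_carrier [simp]: "edge_vec G v n e \<in> carrier_vec n"
  by (simp add: edge_vec_def)

text \<open>The case distinctions in \<open>kirchhoff\<close> disappear because \<open>omega\<close>
  vanishes off the incidences and has modulus 1 on them: on the diagonal each incident edge
  contributes 1, and off the diagonal the inverse in \<open>phi\<close> is a conjugate.\<close>

lemma kirchhoff_index:
  assumes G: "complex_unit_hypergraph G" and v: "v ` {..<n} \<subseteq> verts G" and "i < n" "j < n"
  shows "kirchhoff G v n $$ (i, j) = (\<Sum>e\<in>edges G. omega G (v i, e) * cnj (omega G (v j, e)))"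
proof -
  have fin: "finite (edges G)" using G by (simp add: complex_unit_hypergraph_def)
  have om: "(v k, e) \<in> incidence G \<Longrightarrow> cmod (omega G (v k, e)) = 1"
    "(v k, e) \<notin> incidence G \<Longrightarrow> omega G (v k, e) = 0" if "k < n" "e \<in> edges G" for k e
  proof -
    have "v k \<in> verts G" using v that by auto
    moreover from this have "omega G (v k, e) \<in> {z. cmod z = 1} \<union> {0}"
      using G that(2) unfolding complex_unit_hypergraph_def by (blast dest: PiE_mem)
    ultimately show "(v k, e) \<in> incidence G \<Longrightarrow> cmod (omega G (v k, e)) = 1"
      "(v k, e) \<notin> incidence G \<Longrightarrow> omega G (v k, e) = 0"
      using G that(2) unfolding complex_unit_hypergraph_def by auto
  qed
  let ?C = "common_edges G (v i) (v j)"
  have "(\<Sum>e\<in>edges G. omega G (v i, e) * cnj (omega G (v j, e))) =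
      (\<Sum>e\<in>?C. omega G (v i, e) * cnj (omega G (v j, e)))"
    using fin om assms(3,4) by (intro sum.mono_neutral_right) (auto simp: common_edges_def)
  also have "\<dots> = kirchhoff G v n $$ (i, j)"
  proof (cases "i = j")
    case True
    have "(\<Sum>e\<in>?C. omega G (v i, e) * cnj (omega G (v j, e))) = (\<Sum>e\<in>?C. 1)"
      using True assms(3) om(1) by (intro sum.cong) (auto simp: common_edges_def simp flip: complex_norm_square)
    then show ?thesis
      using True assms(3)
      by (simp add: kirchhoff_def degree_mat_def adjacency_mat_def mat_diag_def degr_def common_edges_def)
  next
    case False
    have "inverse z = cnj z" if "cmod z = 1" for z
      by (rule inverse_unique) (simp add: that flip: complex_norm_square)
    \<comment> \<open>The minus sign in \<open>phi\<close> cancels the subtraction of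
      \<open>adjacency_mat\<close>. An empty \<open>?C\<close> is covered too: the sum is then zero,
      like the adjacency entry.\<close>
    then have "(\<Sum>e\<in>?C. omega G (v i, e) * cnj (omega G (v j, e))) = - (\<Sum>e\<in>?C. phi G e (v i) (v j))"
      unfolding sum_negf[symmetric] using assms(4) om(1)
      by (intro sum.cong) (auto simp: common_edges_def phi_def)
    then show ?thesis
      using False assms(3,4)
      by (simp add: kirchhoff_def degree_mat_def adjacency_mat_def mat_diag_def)
  qed
  finally show ?thesis ..
qed

lemma kirchhoff_quadratic_form:
  assumes G: "complex_unit_hypergraph G" and v: "v ` {..<n} \<subseteq> verts G" and x: "x \<in> carrier_vec n"
  shows "(kirchhoff G v n *\<^sub>v x) \<bullet>c x = of_real (\<Sum>e\<in>edges G. (cmod (edge_vec G v n e \<bullet> x))\<^sup>2)"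
proof -
  let ?w = "\<lambda>i e. omega G (v i, e)"
  have w: "edge_vec G v n e \<bullet> x = (\<Sum>i<n. cnj (?w i e) * x $ i)" for e
    using x by (simp add: edge_vec_def scalar_prod_def lessThan_atLeast0)
  have "(kirchhoff G v n *\<^sub>v x) \<bullet>c x =
      (\<Sum>i<n. (\<Sum>j<n. kirchhoff G v n $$ (i, j) * x $ j) * cnj (x $ i))"
    using x carrier_matD[OF kirchhoff_carrier[of G v n]] by (simp add: scalar_prod_def lessThan_atLeast0)
  \<comment> \<open>Each term is grouped into a factor in \<open>j\<close> and the conjugate of the
    same expression in \<open>i\<close>. Once \<open>e\<close> is the outermost index, the double
    sum factors into a number times its conjugate.\<close>
  also have "\<dots> = (\<Sum>i<n. \<Sum>j<n. \<Sum>e\<in>edges G. (cnj (?w j e) * x $ j) * cnj (cnj (?w i e) * x $ i))"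
    by (simp add: kirchhoff_index[OF G v] sum_distrib_left sum_distrib_right mult_ac)
  also have "\<dots> = (\<Sum>e\<in>edges G. \<Sum>i<n. \<Sum>j<n. (cnj (?w j e) * x $ j) * cnj (cnj (?w i e) * x $ i))"
    by (subst sum.swap[of _ "{..<n}" "edges G"], subst sum.swap[of _ "edges G" "{..<n}"])
      (simp add: sum.swap[of _ "edges G" "{..<n}"])
  also have "\<dots> = (\<Sum>e\<in>edges G. cnj (edge_vec G v n e \<bullet> x) * (edge_vec G v n e \<bullet> x))"
    unfolding w cnj_sum sum_product by (intro sum.cong refl) (rule mult.commute)
  finally show ?thesis by (simp add: complex_norm_square mult.commute del: of_real_power)
qed

section \<open>Weak deletion of several edges and the interlacing inequalities\<close>

text \<open>Agreement of \<open>omega\<close> is claimed on surviving edges only, since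
  \<open>weak_delete\<close> restricts the function and makes it \<open>undefined\<close> elsewhere.
  \<open>G\<close> varies in the induction because \<open>fold\<close> deletes the head of the list
  first.\<close>

lemma fold_weak_delete:
  assumes "complex_unit_hypergraph G"
  shows "complex_unit_hypergraph (fold weak_delete es G) \<and>
    verts (fold weak_delete es G) = verts G \<and>
    edges (fold weak_delete es G) = edges G - set es \<and>
    (\<forall>x\<in>verts G. \<forall>e\<in>edges G - set es.
      omega (fold weak_delete es G) (x, e) = omega G (x, e))"
  using assms
proof (induction es arbitrary: G)
  case (Cons a es)
  then show ?case
    using Cons.IH[OF complex_unit_hypergraph_weak_delete[OF Cons.prems, of a]]
    by (auto simp: weak_delete_def)
qed simp

theorem theorem4p8:
  fixes G Ghat :: "('v, 'e) hypergraph"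
    and v :: "nat \<Rightarrow> 'v"
    and n r :: nat
    and es :: "'e list"
  assumes "complex_unit_hypergraph G"
    and "bij_betw v {..<n} (verts G)"
    and "distinct es" and "set es \<subseteq> edges G" and "length es = r"
    and "Ghat = fold weak_delete es G"
  shows "\<forall>j\<in>{r + 1..n}.
           eig (kirchhoff G v n) (j - r) \<le> eig (kirchhoff Ghat v n) j \<and>
           eig (kirchhoff Ghat v n) j \<le> eig (kirchhoff G v n) j"
proof
  fix j assume j: "j \<in> {r + 1..n}"
  have Ghat: "complex_unit_hypergraph Ghat" "verts Ghat = verts G" "edges Ghat = edges G - set es"
    "\<And>x e. x \<in> verts G \<Longrightarrow> e \<in> edges G - set es \<Longrightarrow> omega Ghat (x, e) = omega G (x, e)"
    using fold_weak_delete[OF assms(1), of es] assms(6) by auto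
  let ?K = "kirchhoff G v n" and ?L = "kirchhoff Ghat v n"
  let ?q = "\<lambda>e x. (cmod (edge_vec G v n e \<bullet> x))\<^sup>2"
  have v: "v ` {..<n} \<subseteq> verts G" "v ` {..<n} \<subseteq> verts Ghat"
    using assms(2) Ghat(2) by (auto simp: bij_betw_def)
  have fin: "finite (edges G)" using assms(1) by (simp add: complex_unit_hypergraph_def)
  have K: "Re ((?K *\<^sub>v x) \<bullet>c x) = (\<Sum>e\<in>edges G. ?q e x)" if "x \<in> carrier_vec n" for x
    unfolding kirchhoff_quadratic_form[OF assms(1) v(1) that] by simp
  \<comment> \<open>Surviving edges keep their vectors, so the form of \<open>?L\<close> is a
    partial sum of the form of \<open>?K\<close>.\<close>
  have edge: "edge_vec Ghat v n e = edge_vec G v n e" if "e \<in> edges G - set es" for e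
    using v(1) that by (intro eq_vecI) (auto simp: edge_vec_def Ghat(4))
  have L: "Re ((?L *\<^sub>v x) \<bullet>c x) = (\<Sum>e\<in>edges G - set es. ?q e x)" if "x \<in> carrier_vec n" for x
    unfolding kirchhoff_quadratic_form[OF Ghat(1) v(2) that] by (simp add: Ghat(3) edge)
  have hermK: "hermitian_mat ?K" and hermL: "hermitian_mat ?L"
    using hermitian_kirchhoff assms(1) Ghat(1) by blast+
  \<comment> \<open>Orthogonality to the vectors of the deleted edges makes the dropped terms
    vanish, so both forms agree on such \<open>x\<close>; the index shift is
    \<open>length ?ws\<close>, which is \<open>r\<close>.\<close>
  let ?ws = "map (edge_vec G v n) es"
  have "eig ?K (j - length ?ws) \<le> eig ?L j"
  proof (rule eig_le_of_quadratic_form_le[OF kirchhoff_carrier hermK kirchhoff_carrier hermL])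
    fix x assume x: "x \<in> carrier_vec n" and "\<And>w. w \<in> set ?ws \<Longrightarrow> w \<bullet> x = 0"
    then have "(\<Sum>e\<in>edges G. ?q e x) = (\<Sum>e\<in>edges G - set es. ?q e x)"
      using fin by (intro sum.mono_neutral_right) auto
    then show "Re ((?K *\<^sub>v x) \<bullet>c x) \<le> Re ((?L *\<^sub>v x) \<bullet>c x)"
      using K[OF x] L[OF x] by simp
  qed (use j assms(5) in auto)
  \<comment> \<open>The dropped terms are nonnegative, so this comparison holds for every
    \<open>x\<close>; the empty list of conditions makes the index shift zero.\<close>
  moreover have "eig ?L (j - length ([] :: complex vec list)) \<le> eig ?K j"
  proof (rule eig_le_of_quadratic_form_le[OF kirchhoff_carrier hermL kirchhoff_carrier hermK])
    fix x :: "complex vec" assume x: "x \<in> carrier_vec n"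
    show "Re ((?L *\<^sub>v x) \<bullet>c x) \<le> Re ((?K *\<^sub>v x) \<bullet>c x)"
      unfolding K[OF x] L[OF x] using fin by (intro sum_mono2) auto
  qed (use j in auto)
  ultimately show "eig ?K (j - r) \<le> eig ?L j \<and> eig ?L j \<le> eig ?K j"
    using assms(5) by simp
qed

end
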